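(* Let $n\ge2$, let $\mathcal{D}_{n,s}$ be an orthogonally structured positive basis of $\mathbb{R}^n$ with $s\in\{1,\dots,n\}$, and let $k\ge1$. Let $\mathbf{R}^{(1)},\dots,\mathbf{R}^{(k)}$ be $k$ rotation matrices in $\mathbb{R}^{n\times n}$, and for each $j\in\{1,\dots,k\}$ let $\mathcal{D}_{n,s}^{(j)}$ be the family of vectors obtained by applying $\mathbf{R}^{(j)}$ to each vector in $\mathcal{D}_{n,s}$. Then the family $\mathcal{D}_{n,s}^{(1:k)}=\bigcup_{j=1}^k\mathcal{D}_{n,s}^{(j)}$ is a positive $k$-spanning set of $\mathbb{R}^n$, and $$\mathrm{cm}_k\left(\mathcal{D}_{n,s}^{(1:k)}\right)\ge\mathrm{cm}(\mathcal{D}_{n,s}).$$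
   Context: Families of vectors may contain repetitions; unions of families, subfamilies and cardinalities are counted with multiplicity (so $\mathcal{D}_{n,s}^{(1:k)}$ has $k(n+s)$ elements). Positive spanning sets are finite families of nonzero vectors. For a linear subspace $\mathbb{L}$ of $\mathbb{R}^n$ and a finite family $\mathcal{D}$ in $\mathbb{L}$, $\mathrm{pspan}(\mathcal{D})$ is the set of all linear combinations of elements of $\mathcal{D}$ with nonnegative coefficients; $\mathcal{D}$ is a positive spanning set of $\mathbb{L}$ if $\mathrm{pspan}(\mathcal{D})=\mathbb{L}$. A positive basis of $\mathbb{L}$ is a positive spanning set $\mathcal{D}$ of $\mathbb{L}$ such that $\mathrm{pspan}(\mathcal{D}\setminus\{\mathbf{d}\})\neq\mathbb{L}$ for every $\mathbf{d}\in\mathcal{D}$ (where $\mathcal{D}\setminus\{\mathbf{d}\}$ removes exactly one instance of $\mathbf{d}$). It is minimal if it has exactly $\dim(\mathbb{L})+1$ elements (with $\dim\mathbb{L}\ge1$). A positive basis $\mathcal{D}_{n,s}$ of $\mathbb{R}^n$ with $n+s$ elements is an orthogonally structured positive basis (OSPB) if there exist pairwise orthogonal subspaces $\mathbb{L}_1,\dots,\mathbb{L}_s$ of $\mathbb{R}^n$ with $\mathbb{R}^n=\mathbb{L}_1+\cdots+\mathbb{L}_s$ and minimal positive bases $\mathcal{D}_{\mathbb{L}_i}$ of $\mathbb{L}_i$ such that $\mathcal{D}_{n,s}=\mathcal{D}_{\mathbb{L}_1}\cup\cdots\cup\mathcal{D}_{\mathbb{L}_s}$. For $k\ge1$ and a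 finite family $\mathcal{D}$ in $\mathbb{R}^n$, $\mathrm{pspan}_k(\mathcal{D})$ is the intersection of $\mathrm{pspan}(\mathcal{S})$ over all subfamilies $\mathcal{S}\subset\mathcal{D}$ with $|\mathcal{S}|\ge|\mathcal{D}|-k+1$; $\mathcal{D}$ is a positive $k$-spanning set of $\mathbb{R}^n$ if $\mathrm{pspan}_k(\mathcal{D})=\mathbb{R}^n$. For a finite family $\mathcal{D}$ of nonzero vectors in $\mathbb{R}^n$ and $1\le k\le|\mathcal{D}|$, $$\mathrm{cm}_k(\mathcal{D})=\min_{\mathbf{u}\in\mathbb{R}^n,\ \|\mathbf{u}\|=1}\ \max_{\mathcal{S}\subset\mathcal{D},\ |\mathcal{S}|=k}\ \min_{\mathbf{d}\in\mathcal{S}}\frac{\mathbf{u}^\top\mathbf{d}}{\|\mathbf{d}\|},\qquad \mathrm{cm}(\mathcal{D})=\min_{\mathbf{u}\in\mathbb{R}^n,\ \|\mathbf{u}\|=1}\ \max_{\mathbf{d}\in\mathcal{D}}\frac{\mathbf{u}^\top\mathbf{d}}{\|\mathbf{d}\|}.$$ *)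

theory Defs
  imports "HOL-Analysis.Analysis" "HOL-Library.Multiset"
begin

text \<open>
  Finite families of vectors, counted with multiplicity, are multisets: a subfamily is a
  sub-multiset, the cardinality of a family is its \<open>size\<close>, and the union of families is the
  multiset sum.
\<close>

section \<open>Positive spans, positive bases\<close>

text \<open>
  The coefficients are indexed by the distinct vectors of the family, since the coefficients of
  several instances of one vector add up to a single nonnegative coefficient. The span of the
  empty family is \<open>{0}\<close>.
\<close>

definition pspan :: "'a::real_vector multiset \<Rightarrow> 'a set" where
  "pspan D = {(\<Sum>d\<in>set_mset D. c d *\<^sub>R d) | c. \<forall>d\<in>set_mset D. c d \<ge> (0::real)}"

definition positive_spanning_set :: "'a::real_vector set \<Rightarrow> 'a multiset \<Rightarrow> bool" where
  "positive_spanning_set L D \<longleftrightarrow>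
     subspace L \<and> set_mset D \<subseteq> L \<and> 0 \<notin># D \<and> pspan D = L"

definition positive_basis :: "'a::real_vector set \<Rightarrow> 'a multiset \<Rightarrow> bool" where
  "positive_basis L D \<longleftrightarrow>
     positive_spanning_set L D \<and> (\<forall>d\<in>#D. pspan (D - {#d#}) \<noteq> L)"

definition minimal_positive_basis :: "'a::real_vector set \<Rightarrow> 'a multiset \<Rightarrow> bool" where
  "minimal_positive_basis L D \<longleftrightarrow>
     positive_basis L D \<and> dim L \<ge> 1 \<and> size D = dim L + 1"

text \<open>The sum of the subspaces \<open>L i\<close> below is the sum of sets from \<open>Set_Algebras\<close>.\<close>

definition ospb :: "nat \<Rightarrow> 'a::euclidean_space multiset \<Rightarrow> bool" where
  "ospb s D \<longleftrightarrow>
     positive_basis UNIV D \<and> size D = DIM('a) + s \<and>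
     (\<exists>(L :: nat \<Rightarrow> 'a set) (DL :: nat \<Rightarrow> 'a multiset).
        (\<forall>i\<in>{1..s}. subspace (L i)) \<and>
        pairwise (\<lambda>i j. \<forall>x\<in>L i. \<forall>y\<in>L j. orthogonal x y) {1..s} \<and>
        (\<Sum>i=1..s. L i) = UNIV \<and>
        (\<forall>i\<in>{1..s}. minimal_positive_basis (L i) (DL i)) \<and>
        D = (\<Sum>i=1..s. DL i))"

section \<open>Positive \<open>k\<close>-spanning sets\<close>

text \<open>
  The bound \<open>size S \<ge> size D - k + 1\<close> is written without subtraction, which would be truncated
  for \<open>k > size D\<close>.
\<close>

definition pspan_k :: "nat \<Rightarrow> 'a::real_vector multiset \<Rightarrow> 'a set" where
  "pspan_k k D = (\<Inter>S\<in>{S. S \<subseteq># D \<and> size S + k \<ge> size D + 1}. pspan S)"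

definition positive_k_spanning_set :: "nat \<Rightarrow> 'a::real_vector multiset \<Rightarrow> bool" where
  "positive_k_spanning_set k D \<longleftrightarrow> pspan_k k D = UNIV"

section \<open>Cosine measures\<close>

text \<open>
  The minimum over the (infinite) unit sphere is written as an infimum. It is attained, see
  \<open>cm_attained\<close> and \<open>cm_k_attained\<close> below. The definitions are meaningful for families of nonzero
  vectors with \<open>D \<noteq> {#}\<close>, respectively \<open>1 \<le> k \<le> size D\<close>.
\<close>

definition cm :: "'a::euclidean_space multiset \<Rightarrow> real" where
  "cm D = (INF u\<in>{u. norm u = 1}. MAX d\<in>set_mset D. (u \<bullet> d) / norm d)"

definition cm_k :: "nat \<Rightarrow> 'a::euclidean_space multiset \<Rightarrow> real" where
  "cm_k k D = (INF u\<in>{u. norm u = 1}.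
     MAX S\<in>{S. S \<subseteq># D \<and> size S = k}. MIN d\<in>set_mset S. (u \<bullet> d) / norm d)"

lemma continuous_on_MAX:
  fixes f :: "'i \<Rightarrow> 'a::topological_space \<Rightarrow> real"
  assumes "finite I" "I \<noteq> {}" "\<And>i. i \<in> I \<Longrightarrow> continuous_on A (f i)"
  shows "continuous_on A (\<lambda>x. MAX i\<in>I. f i x)"
  using assms
  by (induction rule: finite_ne_induct) (auto intro!: continuous_on_max)

lemma continuous_on_MIN:
  fixes f :: "'i \<Rightarrow> 'a::topological_space \<Rightarrow> real"
  assumes "finite I" "I \<noteq> {}" "\<And>i. i \<in> I \<Longrightarrow> continuous_on A (f i)"
  shows "continuous_on A (\<lambda>x. MIN i\<in>I. f i x)"
  using assms
  by (induction rule: finite_ne_induct) (auto intro!: continuous_on_min)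

lemma finite_submultisets: "finite {S. S \<subseteq># D}"
proof (rule finite_subset)
  show "{S. S \<subseteq># D} \<subseteq> mset ` {xs. set xs \<subseteq> set_mset D \<and> length xs \<le> size D}"
  proof
    fix S assume "S \<in> {S. S \<subseteq># D}"
    then have S: "S \<subseteq># D" by simp
    obtain xs where "S = mset xs" by (metis ex_mset)
    with S show "S \<in> mset ` {xs. set xs \<subseteq> set_mset D \<and> length xs \<le> size D}"
      by (metis (mono_tags, lifting) image_eqI mem_Collect_eq set_mset_mono set_mset_mset
          size_mset size_mset_mono)
  qed
  show "finite (mset ` {xs. set xs \<subseteq> set_mset D \<and> length xs \<le> size D})"
    by (intro finite_imageI finite_lists_length_le) simp
qed

lemma INF_unit_sphere_attained:
  fixes g :: "'a::euclidean_space \<Rightarrow> real"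
  assumes "continuous_on {u. norm u = 1} g"
  shows "\<exists>u. norm u = 1 \<and> g u = (INF u\<in>{u. norm u = 1}. g u) \<and> (\<forall>v. norm v = 1 \<longrightarrow> g u \<le> g v)"
proof -
  have eq: "{u::'a. norm u = 1} = sphere 0 1" by auto
  have "sphere (0::'a) 1 \<noteq> {}" by simp
  then obtain u where u: "norm u = 1" "\<And>v. norm v = 1 \<Longrightarrow> g u \<le> g v"
    using continuous_attains_inf[of "sphere 0 1" g] assms unfolding eq by auto
  then have "(INF u\<in>{u. norm u = 1}. g u) = g u"
    by (intro cInf_eq_minimum) auto
  with u show ?thesis by auto
qed

lemma cm_attained:
  fixes D :: "'a::euclidean_space multiset"
  assumes "D \<noteq> {#}"
  shows "\<exists>u. norm u = 1 \<and> (MAX d\<in>set_mset D. (u \<bullet> d) / norm d) = cm D \<and>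
    (\<forall>v. norm v = 1 \<longrightarrow>
       (MAX d\<in>set_mset D. (u \<bullet> d) / norm d) \<le> (MAX d\<in>set_mset D. (v \<bullet> d) / norm d))"
  unfolding cm_def using assms
  by (intro INF_unit_sphere_attained continuous_on_MAX)
    (auto simp: divide_inverse intro!: continuous_intros)

lemma cm_k_attained:
  fixes D :: "'a::euclidean_space multiset"
  assumes "1 \<le> k" "k \<le> size D"
  defines "g \<equiv> \<lambda>u. MAX S\<in>{S. S \<subseteq># D \<and> size S = k}. MIN d\<in>set_mset S. (u \<bullet> d) / norm d"
  shows "\<exists>u. norm u = 1 \<and> g u = cm_k k D \<and> (\<forall>v. norm v = 1 \<longrightarrow> g u \<le> g v)"
proof -
  obtain xs where xs: "D = mset xs" by (metis ex_mset)
  have "mset (take k xs) \<subseteq># D"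
    unfolding xs by (metis append_take_drop_id mset_append mset_subset_eq_add_left)
  then have "mset (take k xs) \<in> {S. S \<subseteq># D \<and> size S = k}"
    using assms(2) by (simp add: xs)
  then have ne: "{S. S \<subseteq># D \<and> size S = k} \<noteq> {}" by blast
  have "continuous_on {u. norm u = 1} g"
    unfolding g_def
  proof (rule continuous_on_MAX)
    show "finite {S. S \<subseteq># D \<and> size S = k}"
      by (rule finite_subset[OF _ finite_submultisets[of D]]) auto
    show "{S. S \<subseteq># D \<and> size S = k} \<noteq> {}" by (rule ne)
    fix S assume "S \<in> {S. S \<subseteq># D \<and> size S = k}"
    then have "S \<noteq> {#}" using assms(1) by auto
    then show "continuous_on {u. norm u = 1} (\<lambda>u. MIN d\<in>set_mset S. (u \<bullet> d) / norm d)"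
      by (intro continuous_on_MIN) (auto simp: divide_inverse intro!: continuous_intros)
  qed
  then show ?thesis
    unfolding cm_k_def g_def by (rule INF_unit_sphere_attained)
qed

end

theory Submission
  imports Defs
begin

text \<open>
  Removing at most \<open>k - 1\<close> vectors from the union of \<open>k\<close> families cannot damage all of them: one
  of the families survives intact (\<open>pigeonhole_union_mset\<close>). Each rotated copy of \<open>D\<close> is a
  positive spanning set, since linear maps carry \<open>pspan D\<close> into the positive span of the image
  family and rotations are surjective. So every subfamily that \<open>pspan_k\<close> admits contains a
  positive spanning set.

  For the cosine measure, a rotation only moves the point of the unit sphere from which \<open>D\<close> is
  viewed, so for every unit vector \<open>u\<close> each of the \<open>k\<close> copies has a member whose cosine with \<open>u\<close>
  is at least \<open>cm D\<close>. These members, one from each copy, form a subfamily of size \<open>k\<close> that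
  witnesses the bound for \<open>cm_k\<close> (\<open>cm_le_cm_k_union\<close>).
\<close>

text \<open>
  Multiplicities prevent a direct count of the damaged families, because a missing vector may
  occur in several of them. In the induction, a family that is not contained in \<open>S\<close> is therefore
  charged for one missing instance and all of it is subtracted from \<open>S\<close>.
\<close>

lemma pigeonhole_union_mset:
  assumes "finite A" "S \<subseteq># (\<Sum>j\<in>A. F j)" "size (\<Sum>j\<in>A. F j) < size S + card A"
  shows "\<exists>j\<in>A. F j \<subseteq># S"
  using assms
proof (induction A arbitrary: S rule: finite_induct)
  case empty
  then show ?case by simp
next
  case (insert a A)
  show ?case
  proof (cases "F a \<subseteq># S")
    case False
    then have "S \<inter># F a \<subset># F a"
      by (metis subset_mset.inf.cobounded1 subset_mset.inf.cobounded2 subset_mset.le_neq_trans)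
    then have "size (S \<inter># F a) < size (F a)"
      by (rule mset_subset_size)
    moreover have "size S = size (S \<inter># F a) + size (S - F a)"
      by (metis diff_intersect_left_idem size_Diff_submset size_mset_mono le_add_diff_inverse
          subset_mset.inf.cobounded1)
    ultimately have "size (\<Sum>j\<in>A. F j) < size (S - F a) + card A"
      using insert by simp
    moreover have "S - F a \<subseteq># (\<Sum>j\<in>A. F j)"
      using insert by (simp add: subset_eq_diff_conv add.commute)
    ultimately obtain j where "j \<in> A" "F j \<subseteq># S - F a"
      using insert.IH by blast
    then show ?thesis
      by (meson diff_subset_eq_self insertI2 subset_mset.order_trans)
  qed simp
qed

lemma sum_subseteq_mset_mono:
  assumes "\<And>j. j \<in> A \<Longrightarrow> F j \<subseteq># G j"
  shows "(\<Sum>j\<in>A. F j) \<subseteq># (\<Sum>j\<in>A. G j)"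
  using assms by (induction A rule: infinite_finite_induct) (auto intro: subset_mset.add_mono)

lemma pspan_mono:
  assumes "S \<subseteq># T"
  shows "pspan S \<subseteq> pspan T"
proof
  fix x assume "x \<in> pspan S"
  then obtain c where c: "\<forall>d\<in>#S. c d \<ge> 0" and x: "x = (\<Sum>d\<in>set_mset S. c d *\<^sub>R d)"
    unfolding pspan_def by blast
  define c' where "c' d = (if d \<in># S then c d else 0)" for d
  have "x = (\<Sum>d\<in>set_mset T. c' d *\<^sub>R d)"
    unfolding x using set_mset_mono[OF assms]
    by (intro sum.mono_neutral_cong_left) (auto simp: c'_def)
  moreover have "\<forall>d\<in>#T. c' d \<ge> 0"
    using c by (simp add: c'_def)
  ultimately show "x \<in> pspan T"
    unfolding pspan_def by blast
qed

lemma linear_image_pspan_subset: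
  assumes "linear f"
  shows "f ` pspan D \<subseteq> pspan (image_mset f D)"
proof
  fix x assume "x \<in> f ` pspan D"
  then obtain c where c: "\<forall>d\<in>#D. c d \<ge> 0" and x: "x = f (\<Sum>d\<in>set_mset D. c d *\<^sub>R d)"
    unfolding pspan_def by blast
  \<comment> \<open>Distinct vectors of \<open>D\<close> with the same image pool their coefficients.\<close>
  define c' where "c' y = (\<Sum>d | d \<in># D \<and> f d = y. c d)" for y
  have "x = (\<Sum>d\<in>set_mset D. c d *\<^sub>R f d)"
    using assms by (simp add: x linear_sum linear_cmul)
  also have "\<dots> = (\<Sum>y\<in>f ` set_mset D. \<Sum>d | d \<in># D \<and> f d = y. c d *\<^sub>R f d)"
    by (rule sum.image_gen) simp
  also have "\<dots> = (\<Sum>y\<in>set_mset (image_mset f D). c' y *\<^sub>R y)"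
    by (auto simp: c'_def scaleR_left.sum intro!: sum.cong)
  finally have "x = (\<Sum>y\<in>set_mset (image_mset f D). c' y *\<^sub>R y)" .
  moreover have "\<forall>y\<in>#image_mset f D. c' y \<ge> 0"
    using c by (auto simp: c'_def intro!: sum_nonneg)
  ultimately show "x \<in> pspan (image_mset f D)"
    unfolding pspan_def by blast
qed

lemma positive_k_spanning_set_union:
  assumes "\<And>j. j \<in> {1..k} \<Longrightarrow> pspan (F j) = UNIV"
  shows "positive_k_spanning_set k (\<Sum>j=1..k. F j)"
proof -
  have "pspan S = UNIV"
    if "S \<subseteq># (\<Sum>j=1..k. F j)" "size S + k \<ge> size (\<Sum>j=1..k. F j) + 1" for S
  proof -
    have "\<exists>j\<in>{1..k}. F j \<subseteq># S"
      using that by (intro pigeonhole_union_mset) auto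
    then show ?thesis
      using assms pspan_mono by blast
  qed
  then show ?thesis
    unfolding positive_k_spanning_set_def pspan_k_def by auto
qed

lemma orthogonal_image_large_cosine:
  fixes D :: "'a::euclidean_space multiset" and f :: "'a \<Rightarrow> 'a"
  assumes f: "orthogonal_transformation f" and "D \<noteq> {#}" "norm u = 1"
  shows "\<exists>d\<in>#image_mset f D. cm D \<le> (u \<bullet> d) / norm d"
proof -
  obtain v where v: "u = f v"
    using orthogonal_transformation_surj[OF f] by (metis surjD)
  then have "norm v = 1"
    using f \<open>norm u = 1\<close> by (simp add: orthogonal_transformation_norm)
  then have "cm D \<le> (MAX d\<in>set_mset D. (v \<bullet> d) / norm d)"
    using cm_attained[OF \<open>D \<noteq> {#}\<close>] by metis
  also have "\<dots> \<in> (\<lambda>d. (v \<bullet> d) / norm d) ` set_mset D"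
    using \<open>D \<noteq> {#}\<close> by (intro Max_in) auto
  ultimately obtain d where "d \<in># D" "cm D \<le> (v \<bullet> d) / norm d"
    by auto
  moreover from f have "(u \<bullet> f d) / norm (f d) = (v \<bullet> d) / norm d"
    by (simp add: v orthogonal_transformation_norm orthogonal_transformation_def)
  ultimately show ?thesis
    by (auto intro!: bexI[of _ d])
qed

text \<open>
  A transversal of the copies, made of a vector of large cosine from each, competes in the
  maximum that defines \<open>cm_k\<close>.
\<close>

lemma cm_le_cm_k_union:
  fixes D :: "'a::euclidean_space multiset" and f :: "nat \<Rightarrow> 'a \<Rightarrow> 'a"
  assumes "D \<noteq> {#}" "k \<ge> 1" and f: "\<And>j. j \<in> {1..k} \<Longrightarrow> orthogonal_transformation (f j)"
  shows "cm D \<le> cm_k k (\<Sum>j=1..k. image_mset (f j) D)"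
proof -
  let ?U = "\<Sum>j=1..k. image_mset (f j) D"
  let ?m = "\<lambda>u S. MIN d\<in>set_mset S. (u \<bullet> d) / norm d"
  have "cm D \<le> (MAX S\<in>{S. S \<subseteq># ?U \<and> size S = k}. ?m u S)" if u: "norm u = 1" for u
  proof -
    have "\<forall>j\<in>{1..k}. \<exists>d\<in>#image_mset (f j) D. cm D \<le> (u \<bullet> d) / norm d"
      using orthogonal_image_large_cosine[OF f \<open>D \<noteq> {#}\<close> u] by blast
    then obtain g where g: "\<And>j. j \<in> {1..k} \<Longrightarrow> g j \<in># image_mset (f j) D"
        "\<And>j. j \<in> {1..k} \<Longrightarrow> cm D \<le> (u \<bullet> g j) / norm (g j)"
      by metis
    define T where "T = (\<Sum>j=1..k. {#g j#})"
    have T_set: "set_mset T = g ` {1..k}"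
      by (auto simp: T_def set_mset_sum)
    have "T \<subseteq># ?U"
      unfolding T_def using g(1)
      by (intro sum_subseteq_mset_mono) (simp only: single_subset_iff)
    moreover have "size T = k"
      by (simp add: T_def size_multiset_sum)
    ultimately have "?m u T \<le> (MAX S\<in>{S. S \<subseteq># ?U \<and> size S = k}. ?m u S)"
      by (intro Max_ge finite_imageI finite_subset[OF _ finite_submultisets[of ?U]]) auto
    moreover have "cm D \<le> ?m u T"
      using g(2) \<open>k \<ge> 1\<close> by (intro Min.boundedI) (auto simp: T_set)
    ultimately show ?thesis
      by linarith
  qed
  moreover have "{u::'a. norm u = 1} \<noteq> {}"
    using vector_choose_size[of 1] by auto
  ultimately show ?thesis
    unfolding cm_k_def by (intro cINF_greatest) auto
qed

theorem proposition4p1: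
  fixes D :: "(real ^ 'n) multiset"
    and R :: "nat \<Rightarrow> real ^ 'n ^ 'n"
    and s k :: nat
  assumes "CARD('n) \<ge> 2"
    and "1 \<le> s" and "s \<le> CARD('n)"
    and "ospb s D"
    and "k \<ge> 1"
    and "\<And>j. j \<in> {1..k} \<Longrightarrow> rotation_matrix (R j)"
  shows "positive_k_spanning_set k (\<Sum>j=1..k. image_mset ((*v) (R j)) D) \<and>
         cm_k k (\<Sum>j=1..k. image_mset ((*v) (R j)) D) \<ge> cm D"
proof
  have orth: "orthogonal_transformation ((*v) (R j))" if "j \<in> {1..k}" for j
    using assms(6)[OF that]
    by (simp add: rotation_matrix_def orthogonal_transformation_matrix)
  have D: "pspan D = UNIV" "D \<noteq> {#}"
    using \<open>ospb s D\<close> \<open>1 \<le> s\<close>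
    by (auto simp: ospb_def positive_basis_def positive_spanning_set_def)
  have "pspan (image_mset ((*v) (R j)) D) = UNIV" if "j \<in> {1..k}" for j
    using linear_image_pspan_subset[of "(*v) (R j)" D] D(1)
      orthogonal_transformation_surj[OF orth[OF that]] by auto
  then show "positive_k_spanning_set k (\<Sum>j=1..k. image_mset ((*v) (R j)) D)"
    by (rule positive_k_spanning_set_union)
  show "cm_k k (\<Sum>j=1..k. image_mset ((*v) (R j)) D) \<ge> cm D"
    using D(2) \<open>k \<ge> 1\<close> orth by (rule cm_le_cm_k_union)
qed

end
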